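(* Let $p,r\in[0,1)$ and let $W_{p,r}$ be the Bell functional on behaviors $\mathrm{P}=(\mathrm{p}(ab|xy))_{a,b,x,y\in\{0,1\}}$ given by $$W_{p,r}(\mathrm{P}) = 1 - \mathrm{p}(11|00) - (1-r)\,\mathrm{p}(01|01) - (1-p)\,\mathrm{p}(10|10) + (1-p)(1-r)\,\mathrm{p}(11|11).$$ Then the following properties hold. 1. For all two-way signaling local behaviors $\mathrm{P}\in\mathbb{S}_{(p,1),(r,1)}$, $W_{p,r}(\mathrm{P})\le 1$. 2. There exists a non-signaling quantum behavior $\mathrm{P}$ such that $W_{p,r}(\mathrm{P})>1$.
   Context: A behavior is a family of conditional probabilities $\mathrm{P}=(\mathrm{p}(ab|xy))$, where $a$ and $b$ are Alice's and Bob's outputs and $x$ and $y$ are their inputs, $a,b,x,y\in\{0,1\}$, with $\mathrm{p}(ab|xy)\ge0$ and $\sum_{a,b}\mathrm{p}(ab|xy)=1$ for all $x,y$. The polytope $\mathbb{S}_{(p,q),(r,s)}$, for $p,q,r,s\in[0,1]$: the set of behaviors of the form $$\mathrm{p}(ab|xy)=\sum_\lambda \mathrm{p}_\Lambda(\lambda)\sum_{\tilde x,\tilde y\in\{0,1\}}\mathrm{p}_{\tilde Y|Y}(\tilde y|y)\,\mathrm{p}_{\tilde X|X}(\tilde x|x)\,\mathrm{p}_A(a|x,\tilde y,\lambda)\,\mathrm{p}_B(b|\tilde x,y,\lambda),$$ where $\mathrm{p}_\Lambda$ is a distribution of a hidden variable, $\mathrm{p}_A,\mathrm{p}_B$ are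 arbitrary conditional distributions on $\{0,1\}$, and the channels are fixed by $\mathrm{p}_{\tilde X|X}(0|0)=p$, $\mathrm{p}_{\tilde X|X}(1|1)=q$, $\mathrm{p}_{\tilde Y|Y}(0|0)=r$, $\mathrm{p}_{\tilde Y|Y}(1|1)=s$. A non-signaling quantum behavior is one of the form $\mathrm{p}(ab|xy)=\mathrm{Tr}[(M_{a|x}\otimes N_{b|y})\rho]$, where $\rho$ is a density operator on a tensor product $\mathcal H_{Q_A}\otimes\mathcal H_{Q_B}$ of Hilbert spaces and $\{M_{a|x}\}_a$, $\{N_{b|y}\}_b$ are two-outcome projective measurements on $\mathcal H_{Q_A}$ and $\mathcal H_{Q_B}$ for each $x,y\in\{0,1\}$. *)

theory Defs
  imports "HOL-Probability.Probability_Mass_Function" "HOL-Library.Z2"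
begin

text \<open>Inputs and outputs are elements \<^term>\<open>0\<close>, \<^term>\<open>1\<close> of the two-element type \<^typ>\<open>bit\<close>.
  For \<open>P :: behavior\<close>, the value \<open>P a b x y\<close> is p(ab|xy): outputs first, then inputs.\<close>

type_synonym behavior = "bit \<Rightarrow> bit \<Rightarrow> bit \<Rightarrow> bit \<Rightarrow> real"

definition is_behavior :: "behavior \<Rightarrow> bool" where
  "is_behavior P \<longleftrightarrow>
     (\<forall>a b x y. 0 \<le> P a b x y) \<and> (\<forall>x y. (\<Sum>a\<in>{0, 1}. \<Sum>b\<in>{0, 1}. P a b x y) = 1)"

definition bell_W :: "real \<Rightarrow> real \<Rightarrow> behavior \<Rightarrow> real" where
  "bell_W p r P =
     1 - P 1 1 0 0 - (1 - r) * P 0 1 0 1 - (1 - p) * P 1 0 1 0 + (1 - p) * (1 - r) * P 1 1 1 1"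


section \<open>Two-way signaling local behaviors\<close>

text \<open>\<open>channel u v z' z\<close> is the probability of output \<open>z'\<close> given input \<open>z\<close> for the binary channel
  that transmits 0 correctly with probability \<open>u\<close> and 1 with probability \<open>v\<close>.\<close>

definition channel :: "real \<Rightarrow> real \<Rightarrow> bit \<Rightarrow> bit \<Rightarrow> real" where
  "channel u v z' z =
     (if z = 0 then (if z' = 0 then u else 1 - u) else (if z' = 1 then v else 1 - v))"

text \<open>The hidden variable is discrete; as a discrete distribution has countable support, its values
  are taken in \<^typ>\<open>nat\<close>. \<open>pA x y' l\<close> is Alice's output distribution given her input \<open>x\<close>,
  the symbol \<open>y'\<close> received from Bob, and \<open>l\<close>; \<open>pB x' y l\<close> is Bob's.\<close>

definition signaling_local ::
  "real \<times> real \<Rightarrow> real \<times> real \<Rightarrow> behavior set" where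
  "signaling_local = (\<lambda>(p, q) (r, s).
     {P. is_behavior P \<and>
        (\<exists>(\<mu> :: nat pmf) (pA :: bit \<Rightarrow> bit \<Rightarrow> nat \<Rightarrow> bit pmf) (pB :: bit \<Rightarrow> bit \<Rightarrow> nat \<Rightarrow> bit pmf).
           \<forall>a b x y. P a b x y =
             (\<Sum>\<^sub>\<infinity>l. pmf \<mu> l * (\<Sum>x'\<in>{0, 1}. \<Sum>y'\<in>{0, 1}.
                channel r s y' y * channel p q x' x * pmf (pA x y' l) a * pmf (pB x' y l) b)))})"


section \<open>Operators on Hilbert spaces\<close>

text \<open>Every complex Hilbert space is isometrically isomorphic to \<open>\<ell>\<^sup>2(I)\<close> for an index set \<open>I\<close>
  of an orthonormal basis, and \<open>\<ell>\<^sup>2(I) \<otimes> \<ell>\<^sup>2(J) = \<ell>\<^sup>2(I \<times> J)\<close>. Elements of \<open>\<ell>\<^sup>2(I)\<close> are represented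
  by functions vanishing outside \<open>I\<close>; operators by functions of which only the values on \<open>\<ell>\<^sup>2(I)\<close>
  matter.\<close>

definition l2 :: "'i set \<Rightarrow> ('i \<Rightarrow> complex) set" where
  "l2 I = {v. (\<forall>i. i \<notin> I \<longrightarrow> v i = 0) \<and> (\<lambda>i. (cmod (v i))\<^sup>2) summable_on I}"

definition l2_inner :: "'i set \<Rightarrow> ('i \<Rightarrow> complex) \<Rightarrow> ('i \<Rightarrow> complex) \<Rightarrow> complex" where
  "l2_inner I v w = (\<Sum>\<^sub>\<infinity>i\<in>I. cnj (v i) * w i)"

definition l2_norm :: "'i set \<Rightarrow> ('i \<Rightarrow> complex) \<Rightarrow> real" where
  "l2_norm I v = sqrt (\<Sum>\<^sub>\<infinity>i\<in>I. (cmod (v i))\<^sup>2)"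

type_synonym 'i oper = "('i \<Rightarrow> complex) \<Rightarrow> ('i \<Rightarrow> complex)"

definition bounded_oper :: "'i set \<Rightarrow> 'i oper \<Rightarrow> bool" where
  "bounded_oper I T \<longleftrightarrow>
     (\<forall>v\<in>l2 I. T v \<in> l2 I) \<and>
     (\<forall>v\<in>l2 I. \<forall>w\<in>l2 I. T (\<lambda>i. v i + w i) = (\<lambda>i. T v i + T w i)) \<and>
     (\<forall>c. \<forall>v\<in>l2 I. T (\<lambda>i. c * v i) = (\<lambda>i. c * T v i)) \<and>
     (\<exists>K. \<forall>v\<in>l2 I. l2_norm I (T v) \<le> K * l2_norm I v)"

definition projection :: "'i set \<Rightarrow> 'i oper \<Rightarrow> bool" where
  "projection I E \<longleftrightarrow>
     bounded_oper I E \<and>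
     (\<forall>v\<in>l2 I. E (E v) = E v) \<and>
     (\<forall>v\<in>l2 I. \<forall>w\<in>l2 I. l2_inner I v (E w) = l2_inner I (E v) w)"

text \<open>Orthogonality of the two outcomes follows from \<open>E 0 + E 1 = id\<close>.\<close>

definition projective_measurement :: "'i set \<Rightarrow> (bit \<Rightarrow> 'i oper) \<Rightarrow> bool" where
  "projective_measurement I E \<longleftrightarrow>
     (\<forall>a. projection I (E a)) \<and>
     (\<forall>v\<in>l2 I. (\<lambda>i. \<Sum>a\<in>{0, 1}. E a v i) = v)"

definition ket :: "'i \<Rightarrow> ('i \<Rightarrow> complex)" where
  "ket k = (\<lambda>i. if i = k then 1 else 0)"

definition oper_trace :: "'i set \<Rightarrow> 'i oper \<Rightarrow> complex" where
  "oper_trace I T = (\<Sum>\<^sub>\<infinity>k\<in>I. l2_inner I (ket k) (T (ket k)))"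

text \<open>An infinite sum that does not converge has value 0, so for a positive operator \<open>R\<close> the
  condition \<open>oper_trace I R = 1\<close> includes that \<open>R\<close> is trace class.\<close>

definition density_operator :: "'i set \<Rightarrow> 'i oper \<Rightarrow> bool" where
  "density_operator I R \<longleftrightarrow>
     bounded_oper I R \<and>
     (\<forall>v\<in>l2 I. l2_inner I v (R v) \<in> \<real>\<^sub>\<ge>\<^sub>0) \<and>
     oper_trace I R = 1"

text \<open>\<open>M \<otimes> N = (M \<otimes> id) (id \<otimes> N)\<close>, where the factors act on the slices of a vector of
  \<open>\<ell>\<^sup>2(I \<times> J)\<close> with one index held fixed. See \<open>oper_tensor_product_vector\<close> below.\<close>

definition oper_tensor :: "'i oper \<Rightarrow> 'j oper \<Rightarrow> ('i \<times> 'j) oper" where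
  "oper_tensor M N z = (\<lambda>(i, j). M (\<lambda>i'. N (\<lambda>j'. z (i', j')) j) i)"

lemma oper_tensor_product_vector:
  assumes "bounded_oper I M" "bounded_oper J N" "v \<in> l2 I" "w \<in> l2 J"
  shows "oper_tensor M N (\<lambda>(i, j). v i * w j) = (\<lambda>(i, j). M v i * N w j)"
proof -
  have "N (\<lambda>j. c * w j) = (\<lambda>j. c * N w j)" for c
    using assms unfolding bounded_oper_def by blast
  moreover have "M (\<lambda>i. c * v i) = (\<lambda>i. c * M v i)" for c
    using assms unfolding bounded_oper_def by blast
  then have "M (\<lambda>i. v i * c) = (\<lambda>i. M v i * c)" for c
    by (simp add: mult.commute)
  ultimately show ?thesis
    by (simp add: oper_tensor_def)
qed


section \<open>Non-signaling quantum behaviors\<close>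

text \<open>\<open>M x a\<close> and \<open>N y b\<close> are the measurement operators for outcomes \<open>a\<close>, \<open>b\<close> given inputs \<open>x\<close>, \<open>y\<close>.
  The index sets \<open>I, J\<close> of type \<^typ>\<open>nat set\<close> cover all separable Hilbert spaces, of finite or
  infinite dimension.\<close>

definition quantum_behavior :: "behavior \<Rightarrow> bool" where
  "quantum_behavior P \<longleftrightarrow>
     is_behavior P \<and>
     (\<exists>(I :: nat set) (J :: nat set) M N R.
        (\<forall>x. projective_measurement I (M x)) \<and>
        (\<forall>y. projective_measurement J (N y)) \<and>
        density_operator (I \<times> J) R \<and>
        (\<forall>a b x y. complex_of_real (P a b x y) =
           oper_trace (I \<times> J) (\<lambda>z. oper_tensor (M x a) (N y b) (R z))))"

end

theory Submission
  imports Defs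
begin

text \<open>Of the three negative terms, keep only the contributions in which every received symbol is 1.
  For a fixed hidden variable all four terms then carry the weight \<open>(1 - p) (1 - r)\<close>, and what
  remains is the Clauser--Horne inequality for the response functions given received symbol 1.
  On the quantum side, Hardy's paradox provides a state and measurements for which the three
  negative terms vanish while \<open>p(11|11) > 0\<close>: the state \<open>|00> - |01> - |10>\<close> (normalised), measured
  in the computational basis for input 0 and in the basis \<open>|0> \<plusminus> |1>\<close> for input 1, where the
  outcome 1 belongs to \<open>|1>\<close> and to \<open>|0> + |1>\<close>, respectively.\<close>

section \<open>The bound for signaling local behaviors\<close>

lemma pmf_bit_0: "pmf M (0::bit) = 1 - pmf M 1"
proof -
  have "(\<Sum>b\<in>{0, 1}. pmf M b) = 1"
    using bit.exhaust by (intro sum_pmf_eq_1) auto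
  then show ?thesis
    by simp
qed

text \<open>The gap between the two sides is affine in \<open>a\<close> and in \<open>a'\<close>
  separately, so it is the average of its values at the four deterministic choices of
  \<open>(a, a')\<close>. These values are \<open>b'\<close>, \<open>1 - b\<close>, \<open>b\<close>
  and \<open>1 - b'\<close>, whence the four products in the proof.\<close>

lemma clauser_horne:
  fixes a a' b b' :: real
  assumes "a \<in> {0..1}" "a' \<in> {0..1}" "b \<in> {0..1}" "b' \<in> {0..1}"
  shows "a' * b' \<le> a * b + (1 - a) * b' + a' * (1 - b)"
proof -
  have "a * b + (1 - a) * b' + a' * (1 - b) - a' * b' =
      (1 - a) * (1 - a') * b' + (1 - a) * a' * (1 - b) + a * (1 - a') * b + a * a' * (1 - b')"
    by (simp add: algebra_simps)
  also have "\<dots> \<ge> 0"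
    using assms by (intro add_nonneg_nonneg mult_nonneg_nonneg) auto
  finally show ?thesis
    by simp
qed

text \<open>Domination by \<open>C * pmf \<mu> l\<close> gives absolute convergence. This excludes
  the default value 0 of a divergent \<open>infsum\<close>, so that expectations over the hidden
  variable may be combined linearly.\<close>

lemma has_sum_pmf_mult_bounded:
  fixes g :: "'a \<Rightarrow> real"
  assumes "\<And>l. \<bar>g l\<bar> \<le> C"
  shows "((\<lambda>l. pmf \<mu> l * g l) has_sum (\<Sum>\<^sub>\<infinity>l. pmf \<mu> l * g l)) UNIV"
proof -
  have "Infinite_Sum.abs_summable_on (pmf \<mu>) UNIV"
    unfolding abs_summable_equivalent by (rule pmf_abs_summable)
  then have "(\<lambda>l. C * norm (pmf \<mu> l)) summable_on UNIV"
    by (rule summable_on_cmult_right)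
  moreover have "norm (pmf \<mu> l * g l) \<le> C * norm (pmf \<mu> l)" for l
    using mult_right_mono[OF assms[of l] pmf_nonneg[of \<mu> l]] by (simp add: abs_mult mult.commute)
  ultimately have "(\<lambda>l. norm (pmf \<mu> l * g l)) summable_on UNIV"
    by (rule Infinite_Sum.abs_summable_on_comparison_test')
  then show ?thesis
    by (rule has_sum_infsum[OF abs_summable_summable])
qed

text \<open>The behavior at a single value of the hidden variable, with \<open>q = s = 1\<close>.
  The Bell inequality is shown at this level and then averaged.\<close>

definition local_response ::
  "real \<Rightarrow> real \<Rightarrow> (bit \<Rightarrow> bit \<Rightarrow> bit pmf) \<Rightarrow> (bit \<Rightarrow> bit \<Rightarrow> bit pmf) \<Rightarrow> behavior" where
  "local_response p r A B a b x y =
     (\<Sum>x'\<in>{0, 1}. \<Sum>y'\<in>{0, 1}.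
        channel r 1 y' y * channel p 1 x' x * pmf (A x y') a * pmf (B x' y) b)"

text \<open>A crude bound that serves summability: one summand in [0, 1] for each of the four pairs
  \<open>(x', y')\<close>.\<close>

lemma abs_local_response_le:
  assumes "p \<in> {0..<1}" "r \<in> {0..<1}"
  shows "\<bar>local_response p r A B a b x y\<bar> \<le> 4"
proof -
  have ch: "0 \<le> channel q 1 z' z \<and> channel q 1 z' z \<le> 1" if "q \<in> {0..<1}" for q z' z
    using that by (auto simp: channel_def)
  have t: "0 \<le> u \<and> u \<le> 1"
    if "u = channel r 1 y' y * channel p 1 x' x * pmf (A x y') a * pmf (B x' y) b" for u x' y'
    using ch[OF assms(1), of x' x] ch[OF assms(2), of y' y]
    by (simp add: that pmf_le_1 mult_le_one)
  show ?thesis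
    using t[of _ 0 0, OF refl] t[of _ 0 1, OF refl] t[of _ 1 0, OF refl] t[of _ 1 1, OF refl]
    by (simp add: local_response_def)
qed

lemma bell_W_local_response_le:
  assumes "p \<in> {0..<1}" "r \<in> {0..<1}"
  shows "bell_W p r (local_response p r A B) \<le> 1"
proof -
  define S where "S = local_response p r A B"
  define a b a' b' where "a = pmf (A 0 1) 1" and "b = pmf (B 1 0) 1"
    and "a' = pmf (A 1 1) 1" and "b' = pmf (B 1 1) 1"
  have p: "0 \<le> p" "p \<le> 1" and r: "0 \<le> r" "r \<le> 1"
    using assms by auto
  \<comment> \<open>Input 0 is received as 1 with probability \<open>1 - p\<close> from Alice and
    \<open>1 - r\<close> from Bob; the other three nonnegative summands are dropped.\<close>
  have "(1 - p) * (1 - r) * (a * b) \<le> S 1 1 0 0"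
    using p r by (simp add: S_def local_response_def channel_def a_def b_def mult_ac)
  \<comment> \<open>Bob's input 1 always arrives as 1, so only the factor \<open>1 - p\<close>
    appears here; the coefficient \<open>1 - r\<close> of this term in \<open>bell_W\<close>
    supplies the other one. The term for \<open>S 1 0 1 0\<close> is symmetric.\<close>
  moreover have "(1 - p) * ((1 - a) * b') \<le> S 0 1 0 1"
    using p r by (simp add: S_def local_response_def channel_def a_def b'_def pmf_bit_0[symmetric] mult_ac)
  then have "(1 - r) * ((1 - p) * ((1 - a) * b')) \<le> (1 - r) * S 0 1 0 1"
    using r by (intro mult_left_mono) auto
  moreover have "(1 - r) * (a' * (1 - b)) \<le> S 1 0 1 0"
    using p r by (simp add: S_def local_response_def channel_def b_def a'_def pmf_bit_0[symmetric] mult_ac)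
  then have "(1 - p) * ((1 - r) * (a' * (1 - b))) \<le> (1 - p) * S 1 0 1 0"
    using p by (intro mult_left_mono) auto
  \<comment> \<open>Both channels transmit 1 faithfully, so nothing is lost in the one term that
    enters \<open>bell_W\<close> with a positive sign.\<close>
  moreover have "S 1 1 1 1 = a' * b'"
    by (simp add: S_def local_response_def channel_def a'_def b'_def)
  moreover have "(1 - p) * (1 - r) * (a' * b')
      \<le> (1 - p) * (1 - r) * (a * b + (1 - a) * b' + a' * (1 - b))"
    using p r
    by (intro mult_left_mono clauser_horne) (auto simp: a_def b_def a'_def b'_def pmf_le_1)
  ultimately show ?thesis
    unfolding bell_W_def S_def[symmetric] by (simp add: algebra_simps)
qed

lemma bell_W_signaling_local_le:
  assumes "p \<in> {0..<1}" "r \<in> {0..<1}" and P: "P \<in> signaling_local (p, 1) (r, 1)"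
  shows "bell_W p r P \<le> 1"
proof -
  obtain \<mu> :: "nat pmf" and A B where
    eq: "P a b x y = (\<Sum>\<^sub>\<infinity>l. pmf \<mu> l *
           local_response p r (\<lambda>x y'. A x y' l) (\<lambda>x' y. B x' y l) a b x y)" for a b x y
    using P unfolding signaling_local_def local_response_def by auto
  define S where "S l = local_response p r (\<lambda>x y'. A x y' l) (\<lambda>x' y. B x' y l)" for l
  have hs: "((\<lambda>l. pmf \<mu> l * S l a b x y) has_sum P a b x y) UNIV" for a b x y
    unfolding eq S_def
    by (rule has_sum_pmf_mult_bounded) (rule abs_local_response_le[OF assms(1,2)])
  \<comment> \<open>\<open>1 - bell_W p r\<close> is linear in the behavior without constant term,
    so its value at \<open>P\<close> is the average of its nonnegative values at \<open>S l\<close>.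
    The minus sign sits in the coefficient so that the rules for sums and scalar multiples
    suffice.\<close>
  have "((\<lambda>l. pmf \<mu> l * S l 1 1 0 0 + (1 - r) * (pmf \<mu> l * S l 0 1 0 1)
        + (1 - p) * (pmf \<mu> l * S l 1 0 1 0) + (- ((1 - p) * (1 - r))) * (pmf \<mu> l * S l 1 1 1 1))
      has_sum (P 1 1 0 0 + (1 - r) * P 0 1 0 1 + (1 - p) * P 1 0 1 0
        + (- ((1 - p) * (1 - r))) * P 1 1 1 1)) UNIV"
    by (intro has_sum_add has_sum_cmult_right hs)
  also have "(\<lambda>l. pmf \<mu> l * S l 1 1 0 0 + (1 - r) * (pmf \<mu> l * S l 0 1 0 1)
        + (1 - p) * (pmf \<mu> l * S l 1 0 1 0) + (- ((1 - p) * (1 - r))) * (pmf \<mu> l * S l 1 1 1 1))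
      = (\<lambda>l. pmf \<mu> l * (1 - bell_W p r (S l)))"
    by (simp add: bell_W_def algebra_simps)
  also have "P 1 1 0 0 + (1 - r) * P 0 1 0 1 + (1 - p) * P 1 0 1 0
      + (- ((1 - p) * (1 - r))) * P 1 1 1 1 = 1 - bell_W p r P"
    by (simp add: bell_W_def)
  finally have "0 \<le> 1 - bell_W p r P"
    by (rule has_sum_nonneg) (simp add: S_def bell_W_local_response_le[OF assms(1,2)])
  then show ?thesis
    by simp
qed

section \<open>Matrices as operators\<close>

text \<open>The value 0 outside \<open>I\<close> keeps the result in \<open>l2 I\<close>.\<close>

definition matrix_oper :: "'i set \<Rightarrow> ('i \<Rightarrow> 'i \<Rightarrow> complex) \<Rightarrow> 'i oper" where
  "matrix_oper I m v = (\<lambda>i. if i \<in> I then \<Sum>j\<in>I. m i j * v j else 0)"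

lemma l2_finite: "finite I \<Longrightarrow> l2 I = {v. \<forall>i. i \<notin> I \<longrightarrow> v i = 0}"
  by (simp add: l2_def)

lemma l2_norm_finite: "finite I \<Longrightarrow> l2_norm I v = L2_set (\<lambda>i. cmod (v i)) I"
  by (simp add: l2_norm_def L2_set_def)

lemma l2_inner_finite: "finite I \<Longrightarrow> l2_inner I v w = (\<Sum>i\<in>I. cnj (v i) * w i)"
  by (simp add: l2_inner_def)

lemma bounded_oper_matrix_oper:
  assumes "finite I"
  shows "bounded_oper I (matrix_oper I m)"
proof -
  \<comment> \<open>The constant comes from bounding the l2 norm of the image by its l1 norm and
    each \<open>cmod (v j)\<close> by the l2 norm of \<open>v\<close>.\<close>
  have "l2_norm I (matrix_oper I m v) \<le> (\<Sum>i\<in>I. \<Sum>j\<in>I. cmod (m i j)) * l2_norm I v" for v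
  proof -
    have "l2_norm I (matrix_oper I m v) \<le> (\<Sum>i\<in>I. cmod (matrix_oper I m v i))"
      unfolding l2_norm_finite[OF assms] by (rule L2_set_le_sum) simp
    also have "\<dots> \<le> (\<Sum>i\<in>I. \<Sum>j\<in>I. cmod (m i j) * cmod (v j))"
      by (intro sum_mono) (auto simp: matrix_oper_def norm_mult intro!: sum_norm_le)
    also have "\<dots> \<le> (\<Sum>i\<in>I. \<Sum>j\<in>I. cmod (m i j) * l2_norm I v)"
      unfolding l2_norm_finite[OF assms]
      by (intro sum_mono mult_left_mono member_le_L2_set[OF assms]) auto
    finally show ?thesis
      by (simp add: sum_distrib_right)
  qed
  moreover have "matrix_oper I m (\<lambda>i. v i + w i) = (\<lambda>i. matrix_oper I m v i + matrix_oper I m w i)"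
    for v w
    by (auto simp: matrix_oper_def ring_distribs sum.distrib)
  moreover have "matrix_oper I m (\<lambda>i. c * v i) = (\<lambda>i. c * matrix_oper I m v i)" for c v
    by (auto simp: matrix_oper_def sum_distrib_left mult_ac)
  moreover have "matrix_oper I m v \<in> l2 I" for v
    by (simp add: l2_finite[OF assms] matrix_oper_def)
  ultimately show ?thesis
    unfolding bounded_oper_def by blast
qed

lemma matrix_oper_compose:
  "matrix_oper I m (matrix_oper I n v) = matrix_oper I (\<lambda>i k. \<Sum>j\<in>I. m i j * n j k) v"
proof
  fix i
  have "(\<Sum>j\<in>I. \<Sum>k\<in>I. m i j * (n j k * v k)) = (\<Sum>k\<in>I. \<Sum>j\<in>I. m i j * (n j k * v k))"
    by (rule sum.swap)
  then show "matrix_oper I m (matrix_oper I n v) i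
      = matrix_oper I (\<lambda>i k. \<Sum>j\<in>I. m i j * n j k) v i"
    by (simp add: matrix_oper_def sum_distrib_left sum_distrib_right mult.assoc)
qed

lemma projection_matrix_oper:
  assumes fin: "finite I"
    and hermitian: "\<And>i j. \<lbrakk>i \<in> I; j \<in> I\<rbrakk> \<Longrightarrow> cnj (m i j) = m j i"
    and idem: "\<And>i k. \<lbrakk>i \<in> I; k \<in> I\<rbrakk> \<Longrightarrow> (\<Sum>j\<in>I. m i j * m j k) = m i k"
  shows "projection I (matrix_oper I m)"
proof -
  have "matrix_oper I m (matrix_oper I m v) = matrix_oper I m v" for v
    unfolding matrix_oper_compose by (auto simp: matrix_oper_def idem)
  moreover have "l2_inner I v (matrix_oper I m w) = l2_inner I (matrix_oper I m v) w" for v w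
  proof -
    have "(\<Sum>i\<in>I. \<Sum>j\<in>I. cnj (v i) * (m i j * w j)) = (\<Sum>j\<in>I. \<Sum>i\<in>I. cnj (v i) * (m i j * w j))"
      by (rule sum.swap)
    then show ?thesis
      by (simp add: l2_inner_finite[OF fin] matrix_oper_def sum_distrib_left sum_distrib_right
          hermitian mult_ac)
  qed
  ultimately show ?thesis
    by (simp add: projection_def bounded_oper_matrix_oper[OF fin])
qed

lemma oper_trace_matrix_oper:
  assumes "finite I"
  shows "oper_trace I (matrix_oper I m) = (\<Sum>i\<in>I. m i i)"
proof -
  have "l2_inner I (ket k) (matrix_oper I m (ket k)) = m k k" if "k \<in> I" for k
  proof -
    have "l2_inner I (ket k) (matrix_oper I m (ket k)) = matrix_oper I m (ket k) k"
      using assms that by (simp add: l2_inner_finite ket_def if_distrib[of cnj] mult_delta_left cong: if_cong)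
    also have "\<dots> = m k k"
      using assms that by (simp add: matrix_oper_def ket_def mult_delta_right)
    finally show ?thesis .
  qed
  then show ?thesis
    by (simp add: oper_trace_def assms)
qed

text \<open>The Kronecker product. With \<open>matrix_oper_compose\<close> and
  \<open>oper_trace_matrix_oper\<close> it turns the trace formula for quantum probabilities into a
  finite sum over matrix entries.\<close>

lemma oper_tensor_matrix_oper:
  "oper_tensor (matrix_oper I m) (matrix_oper J n) z
     = matrix_oper (I \<times> J) (\<lambda>(i, j) (k, l). m i k * n j l) z"
  by (auto simp: fun_eq_iff oper_tensor_def matrix_oper_def sum.cartesian_product'
      sum_distrib_left mult.assoc)

text \<open>The rank-one projector |w><w| / <w|w>; dividing here allows vectors with integer
  entries.\<close>

definition pure_state :: "'i set \<Rightarrow> ('i \<Rightarrow> complex) \<Rightarrow> 'i \<Rightarrow> 'i \<Rightarrow> complex" where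
  "pure_state I w i j = w i * cnj (w j) / of_real (\<Sum>k\<in>I. (cmod (w k))\<^sup>2)"

text \<open>The quadratic form at \<open>v\<close> is |<v|w>|^2 / <w|w>, hence nonnegative, and the
  trace is <w|w> / <w|w>.\<close>

lemma density_operator_pure_state:
  assumes fin: "finite I" and nz: "(\<Sum>k\<in>I. (cmod (w k))\<^sup>2) \<noteq> 0"
  shows "density_operator I (matrix_oper I (pure_state I w))"
proof -
  define n where "n = (\<Sum>k\<in>I. (cmod (w k))\<^sup>2)"
  have "n \<ge> 0"
    by (simp add: n_def sum_nonneg)
  have "l2_inner I v (matrix_oper I (pure_state I w) v) = of_real ((cmod (l2_inner I v w))\<^sup>2 / n)" for v
  proof -
    have "l2_inner I v (matrix_oper I (pure_state I w) v)
        = (\<Sum>i\<in>I. cnj (v i) * w i) * (\<Sum>j\<in>I. v j * cnj (w j)) / of_real n"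
      by (simp add: l2_inner_finite[OF fin] matrix_oper_def pure_state_def sum_product
          sum_distrib_left sum_divide_distrib mult_ac flip: n_def)
    also have "(\<Sum>j\<in>I. v j * cnj (w j)) = cnj (\<Sum>i\<in>I. cnj (v i) * w i)"
      by simp
    finally show ?thesis
      by (simp only: l2_inner_finite[OF fin] of_real_divide complex_norm_square)
  qed
  then have positive: "l2_inner I v (matrix_oper I (pure_state I w) v) \<in> \<real>\<^sub>\<ge>\<^sub>0" for v
    using \<open>n \<ge> 0\<close> by simp
  have "(\<Sum>i\<in>I. pure_state I w i i) = (\<Sum>i\<in>I. w i * cnj (w i)) / of_real n"
    by (simp only: pure_state_def n_def sum_divide_distrib)
  then have "(\<Sum>i\<in>I. pure_state I w i i) = of_real n / of_real n"
    by (simp only: n_def of_real_sum complex_norm_square)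
  moreover have "n \<noteq> 0"
    using nz n_def by simp
  ultimately have "(\<Sum>i\<in>I. pure_state I w i i) = 1"
    by simp
  then have "oper_trace I (matrix_oper I (pure_state I w)) = 1"
    by (simp add: oper_trace_matrix_oper[OF fin])
  with positive show ?thesis
    by (simp add: density_operator_def bounded_oper_matrix_oper[OF fin])
qed

section \<open>Hardy's paradox\<close>

text \<open>Entries of the projectors onto |a> for \<open>x = 0\<close>, and for
  \<open>x = 1\<close> onto (|0> + |1>) / sqrt 2 if \<open>a = 1\<close>, (|0> - |1>) / sqrt 2 if
  \<open>a = 0\<close>. Both parties use them. Real entries make the resulting probabilities real by
  construction.\<close>

definition hardy_measurement :: "bit \<Rightarrow> bit \<Rightarrow> nat \<Rightarrow> nat \<Rightarrow> real" where
  "hardy_measurement x a i j =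
     (if x = 0 then (if i = j \<and> (i = 1 \<longleftrightarrow> a = 1) then 1 else 0)
      else (if i = j \<or> a = 1 then 1 / 2 else - 1 / 2))"

definition hardy_vector :: "nat \<times> nat \<Rightarrow> real" where
  "hardy_vector = (\<lambda>(i, j). if i = 1 \<and> j = 1 then 0 else if i = 0 \<and> j = 0 then 1 else - 1)"

text \<open>The factor 1/3 normalises \<^const>\<open>hardy_vector\<close>.\<close>

definition hardy_behavior :: behavior where
  "hardy_behavior a b x y =
     (\<Sum>i\<in>{0, 1}. \<Sum>j\<in>{0, 1}. \<Sum>k\<in>{0, 1}. \<Sum>l\<in>{0, 1}.
        hardy_measurement x a i k * hardy_measurement y b j l
        * hardy_vector (k, l) * hardy_vector (i, j) / 3)"

lemma projective_measurement_hardy: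
  "projective_measurement {0, 1} (\<lambda>a. matrix_oper {0, 1} (\<lambda>i j. of_real (hardy_measurement x a i j)))"
  unfolding projective_measurement_def
proof (intro conjI allI ballI)
  fix a
  show "projection {0, 1} (matrix_oper {0, 1} (\<lambda>i j. of_real (hardy_measurement x a i j)))"
    by (cases x; cases a) (auto simp: hardy_measurement_def intro!: projection_matrix_oper)
next
  fix v :: "nat \<Rightarrow> complex"
  assume "v \<in> l2 {0, 1}"
  then show "(\<lambda>i. \<Sum>a\<in>{0, 1}.
      matrix_oper {0, 1} (\<lambda>i j. of_real (hardy_measurement x a i j)) v i) = v"
    by (cases x) (auto simp: fun_eq_iff l2_finite matrix_oper_def hardy_measurement_def algebra_simps)
qed

lemma is_behavior_hardy: "is_behavior hardy_behavior"
proof -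
  have "0 \<le> hardy_behavior a b x y" for a b x y
    by (cases a; cases b; cases x; cases y;
        simp add: hardy_behavior_def hardy_measurement_def hardy_vector_def)
  moreover have "(\<Sum>a\<in>{0, 1}. \<Sum>b\<in>{0, 1}. hardy_behavior a b x y) = 1" for x y
    by (cases x; cases y;
        simp add: hardy_behavior_def hardy_measurement_def hardy_vector_def)
  ultimately show ?thesis
    by (simp add: is_behavior_def)
qed

lemma quantum_behavior_hardy: "quantum_behavior hardy_behavior"
proof -
  define I :: "nat set" where "I = {0, 1}"
  have finite_I: "finite I"
    by (simp add: I_def)
  define M where "M x a = matrix_oper I (\<lambda>i j. of_real (hardy_measurement x a i j))" for x a
  define R where "R = pure_state (I \<times> I) (\<lambda>k. of_real (hardy_vector k))"
  have norm: "(\<Sum>k\<in>I \<times> I. (cmod (of_real (hardy_vector k)))\<^sup>2) = 3"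
    by (simp add: I_def hardy_vector_def sum.cartesian_product[symmetric])
  have R: "R k l = of_real (hardy_vector k * hardy_vector l / 3)" for k l
    unfolding R_def pure_state_def norm by simp
  have "of_real (hardy_behavior a b x y)
      = oper_trace (I \<times> I) (\<lambda>z. oper_tensor (M x a) (M y b) (matrix_oper (I \<times> I) R z))" for a b x y
    \<comment> \<open>First the trace becomes the diagonal sum of one matrix product; then sums over
      \<open>I \<times> I\<close> are split into iterated sums, with \<open>{0, 1}\<close> folded to
      \<open>I\<close> so that both sides match term by term.\<close>
    by (simp only: M_def oper_tensor_matrix_oper matrix_oper_compose
          oper_trace_matrix_oper[OF finite_cartesian_product[OF finite_I finite_I]],
        simp only: hardy_behavior_def R sum.cartesian_product' split_conv I_def[symmetric],
        simp add: mult.assoc)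
  moreover have "density_operator (I \<times> I) (matrix_oper (I \<times> I) R)"
    unfolding R_def
    by (rule density_operator_pure_state[OF finite_cartesian_product[OF finite_I finite_I]])
       (simp only: norm)
  moreover have "projective_measurement I (M x)" for x
    using projective_measurement_hardy unfolding I_def M_def .
  ultimately show ?thesis
    unfolding quantum_behavior_def using is_behavior_hardy by blast
qed

text \<open>The amplitudes for the three negative terms vanish: there is no |11> component, and 1 -
  1 cancels in the other two. For p(11|11) the amplitude is (1 - 1 - 1) / (2 sqrt 3), with square
  1/12.\<close>

lemma bell_W_hardy: "bell_W p r hardy_behavior = 1 + (1 - p) * (1 - r) / 12"
  by (simp add: bell_W_def hardy_behavior_def hardy_measurement_def hardy_vector_def)

theorem proposition2:
  fixes p r :: real
  assumes "p \<in> {0..<1}" and "r \<in> {0..<1}"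
  shows "(\<forall>P \<in> signaling_local (p, 1) (r, 1). bell_W p r P \<le> 1) \<and>
         (\<exists>P. quantum_behavior P \<and> bell_W p r P > 1)"
proof (intro conjI ballI exI)
  show "bell_W p r P \<le> 1" if "P \<in> signaling_local (p, 1) (r, 1)" for P
    using assms that by (rule bell_W_signaling_local_le)
  show "quantum_behavior hardy_behavior"
    by (rule quantum_behavior_hardy)
  \<comment> \<open>The excess \<open>(1 - p) * (1 - r) / 12\<close> is positive because
    \<open>p\<close> and \<open>r\<close> are strictly below 1.\<close>
  show "bell_W p r hardy_behavior > 1"
    using assms by (simp add: bell_W_hardy)
qed

end
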